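(* Consider a nondegenerate Euclidean triangle $\{1,2,3\}$ with a metric $d$ inducing the edge lengths $\ell_{12},\ell_{13},\ell_{23}$, and let $\gamma_{1,23},\gamma_{2,13},\gamma_{3,12}$ denote its angles at the vertices $1,2,3$, regarded as functions of the edge lengths. Consider variations of the lengths of the form $$\delta\ell_{12}=0,\qquad \delta\ell_{13}=d_{31}\,\delta f_3,\qquad \delta\ell_{23}=d_{32}\,\delta f_3,$$ with $\delta f_3$ arbitrary, and let $\frac{\partial}{\partial f_3}$ be the corresponding derivative, i.e. $\frac{\partial}{\partial f_3}=d_{31}\frac{\partial}{\partial \ell_{13}}+d_{32}\frac{\partial}{\partial\ell_{23}}$. Then $$\frac{\partial\gamma_{1,23}}{\partial f_3}=\frac{h_{13,2}}{\ell_{13}},\qquad \frac{\partial\gamma_{2,13}}{\partial f_3}=\frac{h_{23,1}}{\ell_{23}},\qquad \frac{\partial\gamma_{3,12}}{\partial f_3}=-\frac{h_{13,2}}{\ell_{13}}-\frac{h_{23,1}}{\ell_{23}}.$$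
   Context: A metric $d$ on the triangle $\{1,2,3\}$ is an assignment of real numbers $d_{ij}$ (possibly negative) to the six ordered pairs $(i,j)$, $i\ne j$, such that $\ell_{ij}=d_{ij}+d_{ji}$ are the side lengths of a nondegenerate Euclidean triangle and $d_{12}^2+d_{23}^2+d_{31}^2=d_{21}^2+d_{13}^2+d_{32}^2$. When the triangle is realized in the plane as $v_1v_2v_3$, this condition guarantees a unique center $c_{123}$, whose orthogonal projection onto the line $v_iv_j$ is the point at signed distance $d_{ij}$ from $v_i$ in the direction of $v_j$. For $\{i,j,k\}=\{1,2,3\}$, $h_{ij,k}$ is the signed distance from $c_{123}$ to the line $v_iv_j$, positive if $c_{123}$ is on the same side of the line as the triangle; explicitly $h_{ij,k}=\dfrac{d_{ik}-d_{ij}\cos\gamma_{i,jk}}{\sin\gamma_{i,jk}}$, where $\gamma_{i,jk}$ is the angle at vertex $i$. *)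

theory Defs
  imports "HOL-Analysis.Analysis"
begin

definition nondegenerate :: "(3 \<Rightarrow> real^2) \<Rightarrow> bool" where
  "nondegenerate v \<longleftrightarrow> \<not> collinear {v 1, v 2, v 3}"

text \<open>Only the values \<open>d i j\<close> with \<open>i \<noteq> j\<close> are ever used.\<close>

definition edge_length :: "(3 \<Rightarrow> 3 \<Rightarrow> real) \<Rightarrow> 3 \<Rightarrow> 3 \<Rightarrow> real" where
  "edge_length d i j = d i j + d j i"

definition realizes :: "(3 \<Rightarrow> real^2) \<Rightarrow> (3 \<Rightarrow> 3 \<Rightarrow> real) \<Rightarrow> bool" where
  "realizes v d \<longleftrightarrow> nondegenerate v \<and> (\<forall>i j. i \<noteq> j \<longrightarrow> dist (v i) (v j) = edge_length d i j)"

definition triangle_metric :: "(3 \<Rightarrow> 3 \<Rightarrow> real) \<Rightarrow> bool" where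
  "triangle_metric d \<longleftrightarrow> (\<exists>v. realizes v d) \<and>
     (d 1 2)\<^sup>2 + (d 2 3)\<^sup>2 + (d 3 1)\<^sup>2 = (d 2 1)\<^sup>2 + (d 1 3)\<^sup>2 + (d 3 2)\<^sup>2"

definition is_center :: "(3 \<Rightarrow> real^2) \<Rightarrow> (3 \<Rightarrow> 3 \<Rightarrow> real) \<Rightarrow> real^2 \<Rightarrow> bool" where
  "is_center v d c \<longleftrightarrow> (\<forall>i j. i \<noteq> j \<longrightarrow>
     closest_point (affine hull {v i, v j}) c = v i + (d i j / dist (v i) (v j)) *\<^sub>R (v j - v i))"

definition center :: "(3 \<Rightarrow> real^2) \<Rightarrow> (3 \<Rightarrow> 3 \<Rightarrow> real) \<Rightarrow> real^2" where
  "center v d = (THE c. is_center v d c)"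

text \<open>The signed distance \<open>h\<^sub>i\<^sub>j\<^sub>,\<^sub>k\<close>. The center lies strictly on the side of \<open>v k\<close> iff the
  segment joining them misses the line; for a center on the line the distance is 0 anyway.\<close>

definition height :: "(3 \<Rightarrow> real^2) \<Rightarrow> (3 \<Rightarrow> 3 \<Rightarrow> real) \<Rightarrow> 3 \<Rightarrow> 3 \<Rightarrow> 3 \<Rightarrow> real" where
  "height v d i j k =
     (if closed_segment (center v d) (v k) \<inter> affine hull {v i, v j} = {} then 1 else - 1) *
     infdist (center v d) (affine hull {v i, v j})"

text \<open>The angle at \<open>p\<close> between the rays towards \<open>q\<close> and \<open>r\<close>.\<close>

definition vertex_angle :: "real^2 \<Rightarrow> real^2 \<Rightarrow> real^2 \<Rightarrow> real" where
  "vertex_angle p q r = arccos (((q - p) \<bullet> (r - p)) / (norm (q - p) * norm (r - p)))"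

text \<open>Triples of edge lengths are ordered as \<open>(l\<^sub>1\<^sub>2, l\<^sub>1\<^sub>3, l\<^sub>2\<^sub>3)\<close>.\<close>

definition side_lengths :: "(3 \<Rightarrow> real^2) \<Rightarrow> real \<times> real \<times> real" where
  "side_lengths v = (dist (v 1) (v 2), dist (v 1) (v 3), dist (v 2) (v 3))"

definition edge_lengths :: "(3 \<Rightarrow> 3 \<Rightarrow> real) \<Rightarrow> real \<times> real \<times> real" where
  "edge_lengths d = (edge_length d 1 2, edge_length d 1 3, edge_length d 2 3)"

text \<open>The angle \<open>\<gamma>\<^sub>i\<^sub>,\<^sub>j\<^sub>k\<close> as a function of the edge lengths, meaningful on the
  open set of side lengths of nondegenerate triangles.\<close>

definition angle_of_lengths :: "3 \<Rightarrow> 3 \<Rightarrow> 3 \<Rightarrow> real \<times> real \<times> real \<Rightarrow> real" where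
  "angle_of_lengths i j k L =
     (THE \<theta>. \<exists>v. nondegenerate v \<and> side_lengths v = L \<and> \<theta> = vertex_angle (v i) (v j) (v k))"

text \<open>The operator \<open>\<partial>/\<partial>f\<^sub>3 = d\<^sub>3\<^sub>1 \<partial>/\<partial>l\<^sub>1\<^sub>3 + d\<^sub>3\<^sub>2 \<partial>/\<partial>l\<^sub>2\<^sub>3\<close> at the edge lengths of \<open>d\<close>.\<close>

definition f3_derivative :: "(3 \<Rightarrow> 3 \<Rightarrow> real) \<Rightarrow> (real \<times> real \<times> real \<Rightarrow> real) \<Rightarrow> real" where
  "f3_derivative d g =
     d 3 1 * deriv (\<lambda>x. g (edge_length d 1 2, x, edge_length d 2 3)) (edge_length d 1 3) +
     d 3 2 * deriv (\<lambda>x. g (edge_length d 1 2, edge_length d 1 3, x)) (edge_length d 2 3)"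

text \<open>The center exists and is unique, and \<open>height\<close> is given by
  \<open>(d\<^sub>i\<^sub>k - d\<^sub>i\<^sub>j cos \<gamma>) / sin \<gamma>\<close> with \<open>\<gamma>\<close> the angle at \<open>v i\<close>.\<close>


lemma closest_point_line:
  fixes a b c :: "real^2"
  assumes "a \<noteq> b"
  shows "closest_point (affine hull {a, b}) c = a + s *\<^sub>R (b - a) \<longleftrightarrow> (c - a) \<bullet> (b - a) = s * (norm (b - a))\<^sup>2"
proof -
  let ?S = "affine hull {a, b}"
  have S: "x \<in> ?S \<longleftrightarrow> (\<exists>t. x = a + t *\<^sub>R (b - a))" for x
    unfolding affine_hull_2_alt by auto
  define t where "t = (c - a) \<bullet> (b - a) / (norm (b - a))\<^sup>2"
  have nz: "(norm (b - a))\<^sup>2 \<noteq> 0" using assms by simp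
  have t: "(c - a) \<bullet> (b - a) = t * (norm (b - a))\<^sup>2" using nz by (simp add: t_def)
  have "closest_point ?S c = a + t *\<^sub>R (b - a)"
  proof (rule closest_point_unique[symmetric])
    show "convex ?S" by (simp add: affine_imp_convex)
    show "closed ?S" by simp
    show "a + t *\<^sub>R (b - a) \<in> ?S" using S by blast
    show "\<forall>z\<in>?S. dist c (a + t *\<^sub>R (b - a)) \<le> dist c z"
    proof
      fix z assume "z \<in> ?S"
      then obtain r where z: "z = a + r *\<^sub>R (b - a)" using S by blast
      have e: "(norm (c - z))\<^sup>2 = (norm (c - (a + t *\<^sub>R (b - a))))\<^sup>2 + (r - t)\<^sup>2 * (norm (b - a))\<^sup>2"
      proof -
        define w u where "w = c - a" and "u = b - a"
        have wu: "w \<bullet> u = t * (u \<bullet> u)" using t by (simp add: w_def u_def power2_norm_eq_inner)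
        have "(w - r *\<^sub>R u) \<bullet> (w - r *\<^sub>R u) = (w - t *\<^sub>R u) \<bullet> (w - t *\<^sub>R u) + (r - t)\<^sup>2 * (u \<bullet> u)"
          by (simp add: inner_diff_left inner_diff_right inner_commute[of u w] wu power2_eq_square algebra_simps)
        then show ?thesis unfolding z power2_norm_eq_inner w_def u_def by (simp add: diff_diff_eq)
      qed
      have "norm (c - (a + t *\<^sub>R (b - a))) \<le> norm (c - z)"
        by (rule power2_le_imp_le) (use e in auto)
      then show "dist c (a + t *\<^sub>R (b - a)) \<le> dist c z" by (simp add: dist_norm)
    qed
  qed
  moreover have "a + t *\<^sub>R (b - a) = a + s *\<^sub>R (b - a) \<longleftrightarrow> t = s" using assms by simp
  moreover have "t * (norm (b - a))\<^sup>2 = s * (norm (b - a))\<^sup>2 \<longleftrightarrow> t = s" using nz by simp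
  ultimately show ?thesis using t by simp
qed

lemma realizes_distinct: "realizes v d \<Longrightarrow> i \<noteq> j \<Longrightarrow> v i \<noteq> v j"
  unfolding realizes_def nondegenerate_def
  using exhaust_3[of i] exhaust_3[of j] by (auto simp: insert_commute)

lemma is_center_iff:
  assumes "realizes v d"
  shows "is_center v d c \<longleftrightarrow> (\<forall>i j. i \<noteq> j \<longrightarrow> (c - v i) \<bullet> (v j - v i) = d i j * edge_length d i j)"
proof -
  have "(closest_point (affine hull {v i, v j}) c = v i + (d i j / dist (v i) (v j)) *\<^sub>R (v j - v i)) \<longleftrightarrow>
     (c - v i) \<bullet> (v j - v i) = d i j * edge_length d i j" if "i \<noteq> j" for i j
  proof -
    have ne: "v i \<noteq> v j" using realizes_distinct assms that by blast
    have D: "dist (v i) (v j) = edge_length d i j" "edge_length d i j > 0" using assms that ne unfolding realizes_def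
      by (metis zero_less_dist_iff)+
    have "norm (v j - v i) = edge_length d i j" using D by (simp add: dist_norm norm_minus_commute)
    then show ?thesis unfolding closest_point_line[OF ne] D(1) using D(2) by (simp add: power2_eq_square)
  qed
  then show ?thesis unfolding is_center_def by blast
qed

lemma center_ex1:
  assumes "triangle_metric d" "realizes v d"
  shows "\<exists>!c. is_center v d c"
proof -
  define p q where "p = v 2 - v 1" and "q = v 3 - v 1"
  have nc: "\<not> collinear {0, p, q}" using assms(2) 
    unfolding realizes_def nondegenerate_def p_def q_def
    using collinear_3[of "v 2" "v 1" "v 3"] by (simp add: NO_MATCH_def insert_commute)
  define D where "D = p$1 * q$2 - p$2 * q$1"
  have D: "D \<noteq> 0"
  proof
    assume z: "D = 0"
    have "p \<noteq> 0" using nc by (auto simp: collinear_lemma)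
    then have "p $ 1 \<noteq> 0 \<or> p $ 2 \<noteq> 0" by (auto simp: vec_eq_iff forall_2)
    then have "\<exists>c. q = c *\<^sub>R p"
    proof
      assume "p $ 1 \<noteq> 0"
      then have "q = (q$1 / p$1) *\<^sub>R p" using z by (simp add: vec_eq_iff forall_2 D_def field_simps)
      then show ?thesis by blast
    next
      assume "p $ 2 \<noteq> 0"
      then have "q = (q$2 / p$2) *\<^sub>R p" using z by (simp add: vec_eq_iff forall_2 D_def field_simps)
      then show ?thesis by blast
    qed
    then show False using nc by (auto simp: collinear_lemma)
  qed
  have dis: "(1::3) \<noteq> 2" "(1::3) \<noteq> 3" "(2::3) \<noteq> 3" by simp_all
  let ?l = "edge_length d"
  have sym: "?l 2 1 = ?l 1 2" "?l 3 1 = ?l 1 3" "?l 3 2 = ?l 2 3" by (simp_all add: edge_length_def)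
  have pp: "p \<bullet> p = (?l 1 2)\<^sup>2" and qq: "q \<bullet> q = (?l 1 3)\<^sup>2" and pq: "(q - p) \<bullet> (q - p) = (?l 2 3)\<^sup>2"
    using assms(2) dis unfolding realizes_def p_def q_def
    by (auto simp: dist_norm power2_norm_eq_inner[symmetric] norm_minus_commute)
  have main: "is_center v d c \<longleftrightarrow> (c - v 1) \<bullet> p = d 1 2 * ?l 1 2 \<and> (c - v 1) \<bullet> q = d 1 3 * ?l 1 3" for c
  proof
    assume "is_center v d c"
    then show "(c - v 1) \<bullet> p = d 1 2 * ?l 1 2 \<and> (c - v 1) \<bullet> q = d 1 3 * ?l 1 3"
      unfolding is_center_iff[OF assms(2)] p_def q_def using dis by blast
  next
    assume a: "(c - v 1) \<bullet> p = d 1 2 * ?l 1 2 \<and> (c - v 1) \<bullet> q = d 1 3 * ?l 1 3"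
    define w where "w = c - v 1"
    have w: "w \<bullet> p = d 1 2 * ?l 1 2" "w \<bullet> q = d 1 3 * ?l 1 3" using a by (auto simp: w_def)
    have e: "(d 1 2)\<^sup>2 + (d 2 3)\<^sup>2 + (d 3 1)\<^sup>2 = (d 2 1)\<^sup>2 + (d 1 3)\<^sup>2 + (d 3 2)\<^sup>2"
      using assms(1) by (simp add: triangle_metric_def)
    have v: "v 2 = v 1 + p" "v 3 = v 1 + q" "c = v 1 + w" by (simp_all add: p_def q_def w_def)
    have pq2: "2 * (p \<bullet> q) = (?l 1 2)\<^sup>2 + (?l 1 3)\<^sup>2 - (?l 2 3)\<^sup>2"
      using pp qq pq by (simp add: inner_diff_left inner_diff_right inner_commute)
    have 21: "(w - p) \<bullet> (- p) = d 2 1 * ?l 1 2"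
      using w pp by (simp add: inner_diff_left edge_length_def power2_eq_square algebra_simps)
    have 31: "(w - q) \<bullet> (- q) = d 3 1 * ?l 1 3"
      using w qq by (simp add: inner_diff_left edge_length_def power2_eq_square algebra_simps)
    have "2 * ((w - p) \<bullet> (q - p)) = 2 * (d 2 3 * ?l 2 3)"
      using w pp pq2 e by (simp add: inner_diff_left inner_diff_right edge_length_def power2_eq_square algebra_simps)
    then have 23: "(w - p) \<bullet> (q - p) = d 2 3 * ?l 2 3" by simp
    have 32: "(w - q) \<bullet> (p - q) = d 3 2 * ?l 2 3"
      using 23 pq by (simp add: inner_diff_left inner_diff_right edge_length_def power2_eq_square inner_commute algebra_simps)
    show "is_center v d c" unfolding is_center_iff[OF assms(2)] forall_3
      using w 21 31 23 32 by (simp add: v sym inner_commute)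
  qed
  define al be where "al = d 1 2 * ?l 1 2" and "be = d 1 3 * ?l 1 3"
  define w :: "real^2" where "w = vector [(al * q$2 - be * p$2) / D, (be * p$1 - al * q$1) / D]"
  have sol: "u \<bullet> p = al \<and> u \<bullet> q = be \<longleftrightarrow> u = w" for u :: "real^2"
  proof -
    have "u \<bullet> p = al \<and> u \<bullet> q = be \<longleftrightarrow> u$1 * p$1 + u$2 * p$2 = al \<and> u$1 * q$1 + u$2 * q$2 = be"
      by (simp add: inner_vec_def sum_2)
    also have "\<dots> \<longleftrightarrow> u$1 * D = al * q$2 - be * p$2 \<and> u$2 * D = be * p$1 - al * q$1"
    proof
      assume "u$1 * p$1 + u$2 * p$2 = al \<and> u$1 * q$1 + u$2 * q$2 = be"
      then show "u$1 * D = al * q$2 - be * p$2 \<and> u$2 * D = be * p$1 - al * q$1"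
        unfolding D_def by (auto simp: algebra_simps)
    next
      assume h: "u$1 * D = al * q$2 - be * p$2 \<and> u$2 * D = be * p$1 - al * q$1"
      have "(u$1 * p$1 + u$2 * p$2) * D = (u$1 * D) * p$1 + (u$2 * D) * p$2" by algebra
      also have "\<dots> = al * D" using h unfolding D_def by algebra
      finally have 1: "u$1 * p$1 + u$2 * p$2 = al" using D by simp
      have "(u$1 * q$1 + u$2 * q$2) * D = (u$1 * D) * q$1 + (u$2 * D) * q$2" by algebra
      also have "\<dots> = be * D" using h unfolding D_def by algebra
      finally show "u$1 * p$1 + u$2 * p$2 = al \<and> u$1 * q$1 + u$2 * q$2 = be" using D 1 by simp
    qed
    also have "\<dots> \<longleftrightarrow> u = w" using D by (simp add: vec_eq_iff forall_2 w_def field_simps)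
    finally show ?thesis .
  qed
  have "is_center v d c \<longleftrightarrow> c = v 1 + w" for c
    unfolding main al_def[symmetric] be_def[symmetric] sol by (auto simp: algebra_simps)
  then show ?thesis by auto
qed


definition cross2 :: "real^2 \<Rightarrow> real^2 \<Rightarrow> real" where "cross2 u w = u$1 * w$2 - u$2 * w$1"

lemma cross2_eq_0_iff: "u \<noteq> 0 \<Longrightarrow> cross2 u w = 0 \<longleftrightarrow> (\<exists>t. w = t *\<^sub>R u)"
proof
  assume u: "u \<noteq> 0" and z: "cross2 u w = 0"
  have "u $ 1 \<noteq> 0 \<or> u $ 2 \<noteq> 0" using u by (auto simp: vec_eq_iff forall_2)
  then show "\<exists>c. w = c *\<^sub>R u"
  proof
    assume "u $ 1 \<noteq> 0"
    then have "w = (w$1 / u$1) *\<^sub>R u" using z by (simp add: vec_eq_iff forall_2 cross2_def field_simps)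
    then show ?thesis by blast
  next
    assume "u $ 2 \<noteq> 0"
    then have "w = (w$2 / u$2) *\<^sub>R u" using z by (simp add: vec_eq_iff forall_2 cross2_def field_simps)
    then show ?thesis by blast
  qed
qed (auto simp: cross2_def)

lemma height_formula:
  assumes "triangle_metric d" "realizes v d" "i \<noteq> j" "j \<noteq> k" "i \<noteq> k"
  defines "g \<equiv> vertex_angle (v i) (v j) (v k)"
  shows "height v d i j k = (d i k - d i j * cos g) / sin g" "sin g > 0"
proof -
  define c where "c = center v d"
  have c: "is_center v d c" using theI'[OF center_ex1[OF assms(1,2)]] by (simp add: c_def center_def)
  define u w x where "u = v j - v i" and "w = v k - v i" and "x = c - v i"
  define L M where "L = norm u" and "M = norm w"
  have LM: "L = edge_length d i j" "M = edge_length d i k"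
    using assms by (auto simp: L_def M_def u_def w_def realizes_def dist_norm norm_minus_commute)
  have ne: "v i \<noteq> v j" "v i \<noteq> v k" using realizes_distinct assms by blast+
  have pos: "L > 0" "M > 0" "u \<noteq> 0" using ne by (auto simp: L_def M_def u_def w_def)
  have xu: "x \<bullet> u = d i j * L" and xw: "x \<bullet> w = d i k * M"
    using c assms(3,5) unfolding is_center_iff[OF assms(2)] LM x_def u_def w_def by auto
  have mem: "z \<in> affine hull {v i, v j} \<longleftrightarrow> cross2 u (z - v i) = 0" for z
  proof -
    have "z \<in> affine hull {v i, v j} \<longleftrightarrow> (\<exists>t. z - v i = t *\<^sub>R u)"
      unfolding affine_hull_2_alt u_def by (auto simp: diff_eq_eq add.commute)
    then show ?thesis using cross2_eq_0_iff[OF pos(3)] by simp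
  qed
  have set: "{v 1, v 2, v 3} = {v i, v j, v k}"
    using assms(3-5) exhaust_3[of i] exhaust_3[of j] exhaust_3[of k] by (auto simp: insert_commute)
  have "cross2 u w \<noteq> 0"
  proof
    assume "cross2 u w = 0"
    then have "v k \<in> affine hull {v i, v j}" unfolding mem w_def .
    then have "collinear {v i, v j, v k}" 
      by (meson affine_hull_3_imp_collinear)
    then show False using assms(2) set by (simp add: realizes_def nondegenerate_def)
  qed
  note cr = this
  have sq: "(cross2 u w)\<^sup>2 = L\<^sup>2 * M\<^sup>2 - (u \<bullet> w)\<^sup>2"
    unfolding L_def M_def power2_norm_eq_inner by (simp add: inner_vec_def sum_2 cross2_def power2_eq_square algebra_simps)
  have id: "L\<^sup>2 * (x \<bullet> w) - (x \<bullet> u) * (u \<bullet> w) = cross2 u x * cross2 u w"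
    unfolding L_def M_def power2_norm_eq_inner by (simp add: inner_vec_def sum_2 cross2_def power2_eq_square algebra_simps)
  have g: "g = arccos ((u \<bullet> w) / (L * M))" by (simp add: g_def vertex_angle_def u_def w_def L_def M_def)
  have "\<bar>(u \<bullet> w) / (L * M)\<bar> \<le> 1" using Cauchy_Schwarz_ineq2[of u w] pos by (simp add: L_def M_def)
  then have cosg: "cos g = (u \<bullet> w) / (L * M)" and sing: "sin g = sqrt (1 - ((u \<bullet> w) / (L * M))\<^sup>2)"
    unfolding g by (auto simp: cos_arccos_abs sin_arccos_abs)
  have "1 - ((u \<bullet> w) / (L * M))\<^sup>2 = (cross2 u w / (L * M))\<^sup>2"
    unfolding power_divide sq using pos by (simp add: field_simps)
  then have sing: "sin g = \<bar>cross2 u w\<bar> / (L * M)" using sing pos by (simp add: abs_mult)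
  then show "sin g > 0" using cr pos by simp
  have "d i k - d i j * cos g = (L\<^sup>2 * (x \<bullet> w) - (x \<bullet> u) * (u \<bullet> w)) / (L\<^sup>2 * M)"
    unfolding cosg xu xw using pos by (simp add: field_simps power2_eq_square)
  then have rhs: "(d i k - d i j * cos g) / sin g = cross2 u x * sgn (cross2 u w) / L"
    unfolding id sing using pos cr by (simp add: field_simps power2_eq_square sgn_if)
  have inf: "infdist c (affine hull {v i, v j}) = \<bar>cross2 u x\<bar> / L"
  proof -
    have "infdist c (affine hull {v i, v j}) = dist c (closest_point (affine hull {v i, v j}) c)"
      by (subst setdist_closest_point[symmetric]) (auto simp: infdist_eq_setdist)
    also have "\<dots> = norm (x - (d i j / L) *\<^sub>R u)"
      using c assms(3) by (simp add: is_center_def dist_norm x_def u_def L_def norm_minus_commute diff_diff_eq)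
    also have "\<dots> = \<bar>cross2 u x\<bar> / L"
    proof -
      have e: "L\<^sup>2 * (x \<bullet> x) - (x \<bullet> u)\<^sup>2 = (cross2 u x)\<^sup>2"
        unfolding L_def power2_norm_eq_inner by (simp add: inner_vec_def sum_2 cross2_def power2_eq_square algebra_simps)
      have uu: "u \<bullet> u = L\<^sup>2" by (simp add: L_def power2_norm_eq_inner)
      have "(norm (x - (d i j / L) *\<^sub>R u))\<^sup>2 = x \<bullet> x - (d i j)\<^sup>2"
        unfolding power2_norm_eq_inner inner_diff_left inner_diff_right
        using pos by (simp add: inner_commute[of u x] xu uu field_simps power2_eq_square)
      also have "\<dots> = (\<bar>cross2 u x\<bar> / L)\<^sup>2"
        using e pos unfolding xu by (simp add: field_simps)
      finally show ?thesis using pos by (metis abs_ge_zero divide_nonneg_pos norm_ge_zero power2_eq_iff_nonneg)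
    qed
    finally show ?thesis .
  qed
  have seg: "closed_segment c (v k) \<inter> affine hull {v i, v j} = {} \<longleftrightarrow> cross2 u x * cross2 u w > 0"
  proof -
    have "(\<exists>z. z \<in> closed_segment c (v k) \<and> z \<in> affine hull {v i, v j}) \<longleftrightarrow> (\<exists>t. 0 \<le> t \<and> t \<le> 1 \<and> (1 - t) * cross2 u x + t * cross2 u w = 0)"
    proof -
      have "cross2 u ((1 - t) *\<^sub>R c + t *\<^sub>R v k - v i) = (1 - t) * cross2 u x + t * cross2 u w" for t
        by (simp add: cross2_def x_def w_def algebra_simps)
      then show ?thesis unfolding mem closed_segment_def by (auto; metis)
    qed
    also have "\<dots> \<longleftrightarrow> \<not> cross2 u x * cross2 u w > 0"
    proof
      assume "\<exists>t. 0 \<le> t \<and> t \<le> 1 \<and> (1 - t) * cross2 u x + t * cross2 u w = 0"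
      then obtain t where t: "0 \<le> t" "t \<le> 1" "(1 - t) * cross2 u x + t * cross2 u w = 0" by blast
      show "\<not> cross2 u x * cross2 u w > 0"
      proof
        assume p: "cross2 u x * cross2 u w > 0"
        have "(1 - t) * (cross2 u x * cross2 u w) + t * (cross2 u w)\<^sup>2 = 0" using t(3) by (simp add: power2_eq_square) algebra
        moreover have "(1 - t) * (cross2 u x * cross2 u w) \<ge> 0" "t * (cross2 u w)\<^sup>2 \<ge> 0" using t p by auto
        ultimately have "(1 - t) * (cross2 u x * cross2 u w) = 0" "t * (cross2 u w)\<^sup>2 = 0" by linarith+
        then show False using p cr by auto
      qed
    next
      assume n: "\<not> cross2 u x * cross2 u w > 0"
      let ?t = "cross2 u x / (cross2 u x - cross2 u w)"
      have "cross2 u x - cross2 u w \<noteq> 0" using n cr by (auto simp: not_less mult_le_0_iff)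
      then have "0 \<le> ?t \<and> ?t \<le> 1 \<and> (1 - ?t) * cross2 u x + ?t * cross2 u w = 0"
        using n cr by (auto simp: field_simps zero_le_divide_iff divide_le_eq not_less mult_le_0_iff)
      then show "\<exists>t. 0 \<le> t \<and> t \<le> 1 \<and> (1 - t) * cross2 u x + t * cross2 u w = 0" by blast
    qed
    finally show ?thesis by blast
  qed
  show "height v d i j k = (d i k - d i j * cos g) / sin g"
    unfolding height_def c_def[symmetric] inf seg rhs using cr pos
    by (auto simp: sgn_if zero_less_mult_iff abs_if)
qed

end

theory Submission
  imports Defs
begin

text \<open>
  Write \<open>a, b, c\<close> for the lengths of the sides opposite to the vertices with angles
  \<open>A, B, C\<close>.  By the law of cosines the angles are explicit functions of the lengths, namely
  \<open>A = arccos ((b\<^sup>2 + c\<^sup>2 - a\<^sup>2) / (2 b c))\<close>, on the open set cut out by the strict triangle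
  inequalities; on that set every triple is realized by a nondegenerate triangle, so the
  description of an angle through realizations agrees with this formula
  (\<open>angle_of_lengths_eq\<close>).  Differentiating the arc cosine and simplifying with the projection law
  \<open>b cos C + c cos B = a\<close> gives the classical formula
  \<open>dA = a / (b c sin A) (da - cos C db - cos B dc)\<close>
  (\<open>has_derivative_opposite_angle\<close>).  Let \<open>C\<close> be the angle at vertex 3, so that \<open>a = l\<^sub>2\<^sub>3\<close>
  and \<open>b = l\<^sub>1\<^sub>3\<close>.  Substituting \<open>da = d\<^sub>3\<^sub>2\<close>, \<open>db = d\<^sub>3\<^sub>1\<close>, \<open>dc = 0\<close> and using the law of
  sines \<open>a / sin A = c / sin C\<close> turns the right-hand side into
  \<open>(d\<^sub>3\<^sub>2 - d\<^sub>3\<^sub>1 cos C) / (b sin C)\<close>, which is the height of the center over the side from 3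
  to 1, seen from vertex 3, divided by \<open>b\<close>.  The angle at 2 is symmetric.  For the angle at 3 the
  same derivative formula contains \<open>c cos B\<close> and \<open>c cos A\<close>; replacing them by
  \<open>a - b cos C\<close> and \<open>b - a cos C\<close> shows that it is minus the sum of the other two.
\<close>

section \<open>Trigonometry in terms of the side lengths\<close>

definition triangle_sides :: "real \<Rightarrow> real \<Rightarrow> real \<Rightarrow> bool" where
  "triangle_sides a b c \<longleftrightarrow> a < b + c \<and> b < a + c \<and> c < a + b"

definition opposite_angle :: "real \<Rightarrow> real \<Rightarrow> real \<Rightarrow> real" where
  "opposite_angle a b c = arccos ((b\<^sup>2 + c\<^sup>2 - a\<^sup>2) / (2 * b * c))"

lemma triangle_sides_permute:
  "triangle_sides a b c \<Longrightarrow> triangle_sides b a c"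
  "triangle_sides a b c \<Longrightarrow> triangle_sides c a b"
  by (auto simp: triangle_sides_def)

lemma triangle_sides_pos:
  assumes "triangle_sides a b c"
  shows "a > 0" "b > 0" "c > 0"
  using assms by (auto simp: triangle_sides_def)

lemma opposite_angle_commute: "opposite_angle a c b = opposite_angle a b c"
  by (simp add: opposite_angle_def add.commute mult.commute mult.left_commute)

text \<open>The two bounds are \<open>(b + c)\<^sup>2 > a\<^sup>2\<close> and \<open>(b - c)\<^sup>2 < a\<^sup>2\<close> in disguise.\<close>

lemma cosine_quotient_bounds:
  assumes "triangle_sides a b c"
  shows "-1 < (b\<^sup>2 + c\<^sup>2 - a\<^sup>2) / (2 * b * c)" "(b\<^sup>2 + c\<^sup>2 - a\<^sup>2) / (2 * b * c) < 1"
proof -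
  note pos = triangle_sides_pos[OF assms]
  have "(b + c + a) * (b + c - a) > 0" "(a + b - c) * (a + c - b) > 0"
    using assms pos by (auto simp: triangle_sides_def intro!: mult_pos_pos)
  then show "-1 < (b\<^sup>2 + c\<^sup>2 - a\<^sup>2) / (2 * b * c)" "(b\<^sup>2 + c\<^sup>2 - a\<^sup>2) / (2 * b * c) < 1"
    using pos by (simp_all add: field_simps power2_eq_square)
qed

lemma cos_opposite_angle:
  assumes "triangle_sides a b c"
  shows "cos (opposite_angle a b c) = (b\<^sup>2 + c\<^sup>2 - a\<^sup>2) / (2 * b * c)"
  using cosine_quotient_bounds[OF assms] by (simp add: opposite_angle_def)

text \<open>The product of the four linear factors is sixteen times the squared area (Heron).\<close>

lemma sin_opposite_angle:
  assumes "triangle_sides a b c"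
  shows "sin (opposite_angle a b c) =
    sqrt ((a + b + c) * (b + c - a) * (a + c - b) * (a + b - c)) / (2 * b * c)"
proof -
  note pos = triangle_sides_pos[OF assms]
  have "1 - ((b\<^sup>2 + c\<^sup>2 - a\<^sup>2) / (2 * b * c))\<^sup>2 =
      (a + b + c) * (b + c - a) * (a + c - b) * (a + b - c) / (2 * b * c)\<^sup>2"
    using pos by (simp add: field_simps power2_eq_square)
  moreover have "sqrt ((2 * b * c)\<^sup>2) = 2 * b * c"
    using pos by (intro real_sqrt_unique) auto
  ultimately show ?thesis
    using cosine_quotient_bounds[OF assms]
    by (simp add: opposite_angle_def sin_arccos real_sqrt_divide)
qed

lemma sin_opposite_angle_pos:
  assumes "triangle_sides a b c"
  shows "sin (opposite_angle a b c) > 0"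
  unfolding sin_opposite_angle[OF assms]
  using assms triangle_sides_pos[OF assms]
  by (auto simp: triangle_sides_def intro!: divide_pos_pos mult_pos_pos)

text \<open>Both sides are four times the area divided by \<open>2 b\<close>.\<close>

lemma law_of_sines:
  assumes "triangle_sides a b c"
  shows "a * sin (opposite_angle c a b) = c * sin (opposite_angle a b c)"
proof -
  have "(c + a + b) * (a + b - c) * (c + b - a) * (c + a - b) =
      (a + b + c) * (b + c - a) * (a + c - b) * (a + b - c)"
    by algebra
  then show ?thesis
    using triangle_sides_pos[OF assms]
    by (simp add: sin_opposite_angle[OF assms]
        sin_opposite_angle[OF triangle_sides_permute(2)[OF assms]])
qed

lemma projection_law:
  assumes "triangle_sides a b c"
  shows "b * cos (opposite_angle c a b) + c * cos (opposite_angle b a c) = a"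
  unfolding cos_opposite_angle[OF triangle_sides_permute(1)[OF assms]]
    cos_opposite_angle[OF triangle_sides_permute(2)[OF assms]]
  using triangle_sides_pos[OF assms] by (simp add: field_simps power2_eq_square)

text \<open>
  Differentiating the quotient under the arc cosine produces the coefficients
  \<open>b - c cos A\<close> and \<open>c - b cos A\<close>, which the projection law rewrites to \<open>a cos C\<close> and
  \<open>a cos B\<close>; this is where the symmetric shape of the result comes from.
\<close>

lemma has_derivative_opposite_angle:
  fixes a b c :: "'a::real_normed_vector \<Rightarrow> real"
  assumes tri: "triangle_sides (a x) (b x) (c x)"
    and [derivative_intros]: "(a has_derivative a') (at x)" "(b has_derivative b') (at x)"
      "(c has_derivative c') (at x)"
  shows "((\<lambda>x. opposite_angle (a x) (b x) (c x)) has_derivative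
    (\<lambda>t. a x / (b x * c x * sin (opposite_angle (a x) (b x) (c x))) *
      (a' t - cos (opposite_angle (c x) (a x) (b x)) * b' t
            - cos (opposite_angle (b x) (a x) (c x)) * c' t))) (at x)"
proof -
  define q where "q = (\<lambda>x. ((b x)\<^sup>2 + (c x)\<^sup>2 - (a x)\<^sup>2) / (2 * b x * c x))"
  define A B C where "A = opposite_angle (a x) (b x) (c x)"
    and "B = opposite_angle (b x) (a x) (c x)" and "C = opposite_angle (c x) (a x) (b x)"
  note pos = triangle_sides_pos[OF tri]
  have q: "q x = cos A"
    by (simp add: q_def A_def cos_opposite_angle[OF tri])
  have bnd: "-1 < q x" "q x < 1"
    using cosine_quotient_bounds[OF tri] by (auto simp: q_def)
  have sin: "sqrt (1 - (q x)\<^sup>2) = sin A"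
    using bnd by (simp add: A_def opposite_angle_def q_def sin_arccos)
  have sinpos: "sin A > 0"
    using sin_opposite_angle_pos[OF tri] by (simp add: A_def)
  have proj: "b x - c x * cos A = a x * cos C" "c x - b x * cos A = a x * cos B"
    using projection_law[OF triangle_sides_permute(1)[OF tri]]
      projection_law[OF triangle_sides_permute(2)[OF tri]]
    by (auto simp: A_def B_def C_def opposite_angle_commute algebra_simps)
  have num: "(b x)\<^sup>2 + (c x)\<^sup>2 - (a x)\<^sup>2 = 2 * b x * c x * cos A"
    using pos by (simp add: q[symmetric] q_def)
  have "(q has_derivative (\<lambda>t.
      ((2 * b x * b' t + 2 * c x * c' t - 2 * a x * a' t) * (2 * b x * c x) -
        ((b x)\<^sup>2 + (c x)\<^sup>2 - (a x)\<^sup>2) * (2 * (b' t * c x + b x * c' t))) /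
      ((2 * b x * c x) * (2 * b x * c x)))) (at x)"
    unfolding q_def
    by (rule has_derivative_eq_rhs[OF has_derivative_divide'])
      (use pos in \<open>auto intro!: derivative_eq_intros simp: fun_eq_iff algebra_simps\<close>)
  \<comment> \<open>Cancel the common factor after replacing the numerator by \<open>2 b c cos A\<close>.\<close>
  then have "(q has_derivative (\<lambda>t. ((b x - c x * cos A) * b' t + (c x - b x * cos A) * c' t
      - a x * a' t) / (b x * c x))) (at x)"
    by (rule has_derivative_eq_rhs) (use pos in \<open>simp add: num fun_eq_iff field_simps\<close>)
  then have dq: "(q has_derivative (\<lambda>t. - (a x / (b x * c x)) *
      (a' t - cos C * b' t - cos B * c' t))) (at x)"
    unfolding proj
    by (rule has_derivative_eq_rhs) (use pos in \<open>simp add: fun_eq_iff field_simps\<close>)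
  have "((\<lambda>x. arccos (q x)) has_derivative (\<lambda>t. (- (a x / (b x * c x)) *
      (a' t - cos C * b' t - cos B * c' t)) * inverse (- sqrt (1 - (q x)\<^sup>2)))) (at x)"
    by (rule has_derivative_eq_rhs[OF DERIV_compose_FDERIV[OF DERIV_arccos[OF bnd] dq]]) simp
  then have "((\<lambda>x. arccos (q x)) has_derivative (\<lambda>t. a x / (b x * c x * sin A) *
      (a' t - cos C * b' t - cos B * c' t))) (at x)"
    by (rule has_derivative_eq_rhs) (use sinpos in \<open>auto simp: sin fun_eq_iff field_simps\<close>)
  then show ?thesis
    by (simp add: A_def B_def C_def opposite_angle_def q_def)
qed

section \<open>Angles of realized triangles\<close>

text \<open>Equality in a triangle inequality means that one vertex lies between the other two.\<close>

lemma nondegenerate_iff_triangle_sides: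
  "nondegenerate v \<longleftrightarrow> triangle_sides (dist (v 2) (v 3)) (dist (v 1) (v 3)) (dist (v 1) (v 2))"
  unfolding nondegenerate_def collinear_between_cases between triangle_sides_def
  using dist_triangle[of "v 1" "v 2" "v 3"] dist_triangle[of "v 2" "v 3" "v 1"]
    dist_triangle[of "v 1" "v 3" "v 2"]
  by (auto simp: dist_commute)

lemma vertex_angle_eq_opposite_angle:
  "vertex_angle p q r = opposite_angle (dist q r) (dist p q) (dist p r)"
proof -
  have "(dist q r)\<^sup>2 = (dist p q)\<^sup>2 + (dist p r)\<^sup>2 - 2 * ((q - p) \<bullet> (r - p))"
    by (simp add: dist_norm power2_norm_eq_inner inner_diff_left inner_diff_right inner_commute)
  then have "((dist p q)\<^sup>2 + (dist p r)\<^sup>2 - (dist q r)\<^sup>2) / (2 * dist p q * dist p r) =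
      ((q - p) \<bullet> (r - p)) / (dist p q * dist p r)"
    by simp
  then show ?thesis
    by (simp add: vertex_angle_def opposite_angle_def dist_norm norm_minus_commute)
qed

text \<open>
  Place vertex 1 at the origin, vertex 2 on the first axis and vertex 3 at polar angle \<open>A\<close>; the
  law of cosines then gives the third side.
\<close>

lemma triangle_exists:
  assumes "triangle_sides a b c"
  obtains v where "nondegenerate v" "side_lengths v = (c, b, a)"
proof -
  note pos = triangle_sides_pos[OF assms]
  define A where "A = opposite_angle a b c"
  define v :: "3 \<Rightarrow> real^2" where
    "v = (\<lambda>i. if i = 1 then 0 else if i = 2 then vector [c, 0] else vector [b * cos A, b * sin A])"
  have "(c - b * cos A)\<^sup>2 + (b * sin A)\<^sup>2 = b\<^sup>2 * ((sin A)\<^sup>2 + (cos A)\<^sup>2) + c\<^sup>2 - 2 * b * c * cos A"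
    by algebra
  also have "\<dots> = b\<^sup>2 + c\<^sup>2 - 2 * b * c * cos A"
    by simp
  also have "\<dots> = a\<^sup>2"
    using pos by (simp add: A_def cos_opposite_angle[OF assms])
  finally have a: "(c - b * cos A)\<^sup>2 + (b * sin A)\<^sup>2 = a\<^sup>2" .
  have b: "(b * cos A)\<^sup>2 + (b * sin A)\<^sup>2 = b\<^sup>2"
    by (simp add: power_mult_distrib flip: distrib_left)
  have "side_lengths v = (c, b, a)"
    using pos a b
    by (simp add: side_lengths_def v_def dist_vec_def L2_set_def sum_2 dist_real_def)
  moreover from this have "nondegenerate v"
    using assms by (simp add: nondegenerate_iff_triangle_sides side_lengths_def)
  ultimately show thesis using that by blast
qed

text \<open>
  The definite description is meaningful because a realization exists and, by the law of cosines,
  all realizations have the same angle.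
\<close>

lemma angle_of_lengths_eq:
  assumes "triangle_sides a b c"
  shows "angle_of_lengths 1 2 3 (c, b, a) = opposite_angle a b c"
    and "angle_of_lengths 2 1 3 (c, b, a) = opposite_angle b a c"
    and "angle_of_lengths 3 1 2 (c, b, a) = opposite_angle c a b"
proof -
  obtain v where v: "nondegenerate v" "side_lengths v = (c, b, a)"
    using triangle_exists[OF assms] .
  show "angle_of_lengths 1 2 3 (c, b, a) = opposite_angle a b c"
    unfolding angle_of_lengths_def
    by (rule the_equality)
      (use v in \<open>auto simp: vertex_angle_eq_opposite_angle side_lengths_def dist_commute
        opposite_angle_commute\<close>)
  show "angle_of_lengths 2 1 3 (c, b, a) = opposite_angle b a c"
    unfolding angle_of_lengths_def
    by (rule the_equality)
      (use v in \<open>auto simp: vertex_angle_eq_opposite_angle side_lengths_def dist_commute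
        opposite_angle_commute\<close>)
  show "angle_of_lengths 3 1 2 (c, b, a) = opposite_angle c a b"
    unfolding angle_of_lengths_def
    by (rule the_equality)
      (use v in \<open>auto simp: vertex_angle_eq_opposite_angle side_lengths_def dist_commute
        opposite_angle_commute\<close>)
qed

lemma open_triangle_sides: "open {(c, b, a). triangle_sides a b c}"
  unfolding triangle_sides_def case_prod_beta
  by (intro open_Collect_conj open_Collect_less continuous_intros)

text \<open>
  Openness is what makes the explicit formula valid on a whole neighbourhood, so that its
  derivative is also the derivative of the angle.
\<close>

lemma has_derivative_angle_of_lengths:
  assumes "triangle_sides a b c"
  shows "(angle_of_lengths 1 2 3 has_derivative (\<lambda>(c', b', a').
      a / (b * c * sin (opposite_angle a b c)) *
      (a' - cos (opposite_angle c a b) * b' - cos (opposite_angle b a c) * c'))) (at (c, b, a))"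
    and "(angle_of_lengths 2 1 3 has_derivative (\<lambda>(c', b', a').
      b / (a * c * sin (opposite_angle b a c)) *
      (b' - cos (opposite_angle c b a) * a' - cos (opposite_angle a b c) * c'))) (at (c, b, a))"
    and "(angle_of_lengths 3 1 2 has_derivative (\<lambda>(c', b', a').
      c / (a * b * sin (opposite_angle c a b)) *
      (c' - cos (opposite_angle b c a) * a' - cos (opposite_angle a c b) * b'))) (at (c, b, a))"
proof -
  have tri: "triangle_sides a b c" "triangle_sides b a c" "triangle_sides c a b"
    using assms by (auto simp: triangle_sides_def)
  have proj: "((\<lambda>L::real\<times>real\<times>real. fst L) has_derivative fst) (at x)"
    "((\<lambda>L::real\<times>real\<times>real. fst (snd L)) has_derivative (\<lambda>t. fst (snd t))) (at x)"
    "((\<lambda>L::real\<times>real\<times>real. snd (snd L)) has_derivative (\<lambda>t. snd (snd t))) (at x)" for x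
    by (auto intro!: derivative_eq_intros simp: fun_eq_iff)
  have mem: "(c, b, a) \<in> {(c, b, a). triangle_sides a b c}"
    using assms by simp
  show "(angle_of_lengths 1 2 3 has_derivative (\<lambda>(c', b', a').
      a / (b * c * sin (opposite_angle a b c)) *
      (a' - cos (opposite_angle c a b) * b' - cos (opposite_angle b a c) * c'))) (at (c, b, a))"
    by (rule has_derivative_eq_rhs[OF has_derivative_transform_within_open[OF
          has_derivative_opposite_angle[of "\<lambda>L. snd (snd L)" "(c, b, a)" "\<lambda>L. fst (snd L)"
        "\<lambda>L. fst L", OF _ proj(3,2,1)] open_triangle_sides mem]])
      (use tri in \<open>auto simp: angle_of_lengths_eq case_prod_unfold\<close>)
  show "(angle_of_lengths 2 1 3 has_derivative (\<lambda>(c', b', a').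
      b / (a * c * sin (opposite_angle b a c)) *
      (b' - cos (opposite_angle c b a) * a' - cos (opposite_angle a b c) * c'))) (at (c, b, a))"
    by (rule has_derivative_eq_rhs[OF has_derivative_transform_within_open[OF
          has_derivative_opposite_angle[of "\<lambda>L. fst (snd L)" "(c, b, a)" "\<lambda>L. snd (snd L)"
        "\<lambda>L. fst L", OF _ proj(2,3,1)] open_triangle_sides mem]])
      (use tri in \<open>auto simp: angle_of_lengths_eq case_prod_unfold\<close>)
  show "(angle_of_lengths 3 1 2 has_derivative (\<lambda>(c', b', a').
      c / (a * b * sin (opposite_angle c a b)) *
      (c' - cos (opposite_angle b c a) * a' - cos (opposite_angle a c b) * b'))) (at (c, b, a))"
    by (rule has_derivative_eq_rhs[OF has_derivative_transform_within_open[OF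
          has_derivative_opposite_angle[of "\<lambda>L. fst L" "(c, b, a)" "\<lambda>L. snd (snd L)"
        "\<lambda>L. fst (snd L)", OF _ proj(1,3,2)] open_triangle_sides mem]])
      (use tri in \<open>auto simp: angle_of_lengths_eq case_prod_unfold\<close>)
qed

section \<open>The derivative in the direction of the third vertex\<close>

text \<open>The chain rule identifies the two partial derivatives as values of the total derivative on the
  coordinate directions, and linearity combines them.\<close>

lemma f3_derivative_eq:
  assumes g: "(g has_derivative g') (at (edge_lengths d))"
  shows "f3_derivative d g = g' (0, d 3 1, d 3 2)"
proof -
  interpret g': bounded_linear g'
    by (rule has_derivative_bounded_linear[OF g])
  define p q where "p = g' (0, 1, 0)" and "q = g' (0, 0, 1)"
  have lin: "g' (0, s, t) = p * s + q * t" for s t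
  proof -
    have "(0, s, t) = s *\<^sub>R (0, 1, 0) + t *\<^sub>R (0::real, 0::real, 1::real)" by simp
    then show ?thesis
      by (simp only: g'.add g'.scaleR real_scaleR_def p_def q_def mult.commute)
  qed
  let ?c = "edge_length d 1 2" and ?b = "edge_length d 1 3" and ?a = "edge_length d 2 3"
  note g = g[unfolded edge_lengths_def]
  have "((\<lambda>x. (?c, x, ?a)) has_derivative (\<lambda>t. (0, t, 0))) (at ?b)"
    by (intro has_derivative_Pair has_derivative_const has_derivative_ident)
  from has_derivative_compose[OF this g]
  have "((\<lambda>x. g (?c, x, ?a)) has_derivative (\<lambda>t. g' (0, t, 0))) (at ?b)" .
  then have b: "((\<lambda>x. g (?c, x, ?a)) has_field_derivative p) (at ?b)"
    unfolding has_field_derivative_def by (simp add: lin)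
  have "((\<lambda>x. (?c, ?b, x)) has_derivative (\<lambda>t. (0, 0, t))) (at ?a)"
    by (intro has_derivative_Pair has_derivative_const has_derivative_ident)
  from has_derivative_compose[OF this g]
  have "((\<lambda>x. g (?c, ?b, x)) has_derivative (\<lambda>t. g' (0, 0, t))) (at ?a)" .
  then have a: "((\<lambda>x. g (?c, ?b, x)) has_field_derivative q) (at ?a)"
    unfolding has_field_derivative_def by (simp add: lin)
  show ?thesis
    unfolding f3_derivative_def DERIV_imp_deriv[OF a] DERIV_imp_deriv[OF b]
    by (simp add: lin mult.commute)
qed

lemma height_commute: "height v d i j k = height v d j i k"
  by (simp add: height_def insert_commute)

theorem theorem29:
  fixes v :: "3 \<Rightarrow> real^2" and d :: "3 \<Rightarrow> 3 \<Rightarrow> real"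
  assumes "triangle_metric d" and "realizes v d"
  shows "angle_of_lengths 1 2 3 differentiable (at (edge_lengths d)) \<and>
         angle_of_lengths 2 1 3 differentiable (at (edge_lengths d)) \<and>
         angle_of_lengths 3 1 2 differentiable (at (edge_lengths d)) \<and>
         f3_derivative d (angle_of_lengths 1 2 3) = height v d 1 3 2 / edge_length d 1 3 \<and>
         f3_derivative d (angle_of_lengths 2 1 3) = height v d 2 3 1 / edge_length d 2 3 \<and>
         f3_derivative d (angle_of_lengths 3 1 2) =
           - (height v d 1 3 2 / edge_length d 1 3) - height v d 2 3 1 / edge_length d 2 3"
proof -
  define a b c where "a = edge_length d 2 3" and "b = edge_length d 1 3" and "c = edge_length d 1 2"
  define A B C where "A = opposite_angle a b c" and "B = opposite_angle b a c"
    and "C = opposite_angle c a b"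
  have L: "edge_lengths d = (c, b, a)"
    by (simp add: edge_lengths_def a_def b_def c_def)
  have dist: "dist (v 2) (v 3) = a" "dist (v 1) (v 3) = b" "dist (v 1) (v 2) = c"
    using assms(2) by (simp_all add: realizes_def a_def b_def c_def)
  have tri: "triangle_sides a b c"
    using assms(2) by (simp add: realizes_def nondegenerate_iff_triangle_sides dist)
  note pos = triangle_sides_pos[OF tri]
  note D = has_derivative_angle_of_lengths[OF tri, folded L]
  have C: "vertex_angle (v 3) (v 1) (v 2) = C" "vertex_angle (v 3) (v 2) (v 1) = C"
    using dist by (simp_all add: vertex_angle_eq_opposite_angle C_def dist_commute
        opposite_angle_commute)
  \<comment> \<open>Both heights are read off at vertex 3, so that only \<open>d\<^sub>3\<^sub>1\<close>, \<open>d\<^sub>3\<^sub>2\<close> and \<open>C\<close> occur.\<close>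
  have h2: "height v d 1 3 2 = (d 3 2 - d 3 1 * cos C) / sin C"
    using height_formula(1)[OF assms, of 3 1 2] by (simp add: C height_commute[of v d 1])
  have h1: "height v d 2 3 1 = (d 3 1 - d 3 2 * cos C) / sin C"
    using height_formula(1)[OF assms, of 3 2 1] by (simp add: C height_commute[of v d 2])
  have sin: "sin A > 0" "sin B > 0" "sin C > 0"
    using sin_opposite_angle_pos tri triangle_sides_permute[OF tri]
    by (auto simp: A_def B_def C_def)
  have sines: "a * sin C = c * sin A" "b * sin C = c * sin B"
    using law_of_sines[OF tri] law_of_sines[OF triangle_sides_permute(1)[OF tri]]
    by (simp_all add: A_def B_def C_def opposite_angle_commute)
  have proj: "c * cos B = a - b * cos C" "c * cos A = b - a * cos C"
    using projection_law[OF tri] projection_law[OF triangle_sides_permute(1)[OF tri]]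
    by (simp_all add: A_def B_def C_def opposite_angle_commute algebra_simps)
  have "f3_derivative d (angle_of_lengths 1 2 3) = a / (b * (c * sin A)) * (d 3 2 - cos C * d 3 1)"
    by (simp add: f3_derivative_eq[OF D(1)] A_def C_def)
  then have 1: "f3_derivative d (angle_of_lengths 1 2 3) = height v d 1 3 2 / b"
    using pos sin by (simp add: sines(1)[symmetric] h2 field_simps)
  have "f3_derivative d (angle_of_lengths 2 1 3) = b / (a * (c * sin B)) * (d 3 1 - cos C * d 3 2)"
    by (simp add: f3_derivative_eq[OF D(2)] B_def C_def opposite_angle_commute)
  then have 2: "f3_derivative d (angle_of_lengths 2 1 3) = height v d 2 3 1 / a"
    using pos sin by (simp add: sines(2)[symmetric] h1 field_simps)
  have "f3_derivative d (angle_of_lengths 3 1 2) =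
      c / (a * b * sin C) * (- cos B * d 3 2 - cos A * d 3 1)"
    by (simp add: f3_derivative_eq[OF D(3)] A_def B_def C_def opposite_angle_commute)
  also have "\<dots> = - ((c * cos B) * d 3 2 + (c * cos A) * d 3 1) / (a * b * sin C)"
    by (simp add: field_simps)
  also have "\<dots> = - (height v d 1 3 2 / b) - height v d 2 3 1 / a"
    unfolding proj h1 h2 using pos sin by (simp add: field_simps)
  finally have 3: "f3_derivative d (angle_of_lengths 3 1 2) =
      - (height v d 1 3 2 / b) - height v d 2 3 1 / a" .
  show ?thesis
    using D 1 2 3 unfolding differentiable_def a_def b_def by blast
qed

end
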